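(* Let $L \subset \mathbb{R}^2$ be a lattice of rank $2$, and let $u, v \in L^+$ be a pair of (distinct) consecutive indecomposables. Then $u, v$ form a basis for $L$.
   Context: $L^+ = L \cap \mathbb{R}^2_{\ge 0}$ is the set of vectors of $L$ with nonnegative coordinates. A nonzero vector $x \in L^+$ is indecomposable if there do not exist nonzero $y,z\in L^+$ with $x=y+z$. For vectors $u,v$, let $C(u,v) = \{au+bv : a,b \in \mathbb{R}_{\ge 0}\}$. Indecomposables $u,v$ of $L^+$ are called consecutive if the cone $C(u,v)$ contains no indecomposables of $L^+$ other than $u$ and $v$. A basis for $L$ means a $\mathbb{Z}$-basis. *)

theory Defs
  imports "HOL-Analysis.Analysis"
begin

global_interpretation int_module: module "\<lambda>(k::int) (x::'a::real_vector). of_int k *\<^sub>R x"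
  defines int_span = int_module.span
    and int_dependent = int_module.dependent
  by unfold_locales (simp_all add: algebra_simps)

definition int_basis :: "'a::real_vector set \<Rightarrow> 'a set \<Rightarrow> bool" where
  "int_basis B L \<longleftrightarrow> \<not> int_dependent B \<and> int_span B = L"

text \<open>The basis vectors are required to be independent over the reals (\<^const>\<open>independent\<close>),
  not just over the integers: this is what makes the subgroup discrete.\<close>

definition lattice_of_rank :: "nat \<Rightarrow> 'a::real_vector set \<Rightarrow> bool" where
  "lattice_of_rank r L \<longleftrightarrow> (\<exists>B. finite B \<and> card B = r \<and> independent B \<and> L = int_span B)"

definition nonneg_part :: "(real ^ 2) set \<Rightarrow> (real ^ 2) set" where
  "nonneg_part L = {x \<in> L. \<forall>i. 0 \<le> x $ i}"

definition indecomposable :: "(real ^ 2) set \<Rightarrow> real ^ 2 \<Rightarrow> bool" where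
  "indecomposable L x \<longleftrightarrow> x \<in> nonneg_part L \<and> x \<noteq> 0 \<and>
     \<not> (\<exists>y\<in>nonneg_part L. \<exists>z\<in>nonneg_part L. y \<noteq> 0 \<and> z \<noteq> 0 \<and> x = y + z)"

definition cone2 :: "real ^ 2 \<Rightarrow> real ^ 2 \<Rightarrow> (real ^ 2) set" where
  "cone2 u v = {a *\<^sub>R u + b *\<^sub>R v | a b. 0 \<le> a \<and> 0 \<le> b}"

definition consecutive :: "(real ^ 2) set \<Rightarrow> real ^ 2 \<Rightarrow> real ^ 2 \<Rightarrow> bool" where
  "consecutive L u v \<longleftrightarrow> indecomposable L u \<and> indecomposable L v \<and>
     (\<forall>x\<in>cone2 u v. indecomposable L x \<longrightarrow> x = u \<or> x = v)"

end

theory Submission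
  imports Defs
begin

text \<open>
  Fix the indecomposable \<open>u\<close>. It is primitive in \<open>L\<close>, so it extends to a basis \<open>u, w\<close> of \<open>L\<close>, and
  every lattice vector \<open>i u + k w\<close> has a level \<open>k\<close>. The other basis vectors on the same side
  of \<open>u\<close> are the vectors \<open>w + j u\<close> of level one. If that side meets the quadrant at a lattice point,
  then some of the \<open>w + j u\<close> lie in the quadrant, and since \<open>u\<close> is nonnegative and nonzero they leave
  it as \<open>j\<close> decreases; so \<open>w\<close> can be chosen in the quadrant with \<open>w - u\<close> outside.

  The key fact (\<open>indecomposable_neighbour\<close>) is that this extremal \<open>w\<close> is itself indecomposable.
  Given this, let \<open>v = i u + k w\<close> with \<open>k > 0\<close> be the second indecomposable. If \<open>i \<ge> 0\<close>, then
  \<open>v = w + ((k - 1) w + i u)\<close>, and the indecomposability of \<open>v\<close> forces \<open>v = w\<close>. If \<open>i < 0\<close>, then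
  \<open>w = (v - i u) / k\<close> lies in the cone of \<open>u\<close> and \<open>v\<close>, so \<open>w = v\<close> because \<open>u, v\<close> are consecutive.
  Either way \<open>v\<close> is the vector completing \<open>u\<close> to a basis. For \<open>k < 0\<close> one replaces \<open>w\<close> by \<open>-w\<close>,
  and \<open>k = 0\<close> would make \<open>v\<close> a multiple of \<open>u\<close>, hence equal to \<open>u\<close>.
\<close>

section \<open>The nonnegative quadrant along lines parallel to a given vector\<close>

definition quadrant :: "(real ^ 2) set" where
  "quadrant = {x. \<forall>i. 0 \<le> x $ i}"

lemma nonneg_part_eq: "nonneg_part L = L \<inter> quadrant"
  by (auto simp: nonneg_part_def quadrant_def)

lemma quadrant_add: "x \<in> quadrant \<Longrightarrow> y \<in> quadrant \<Longrightarrow> x + y \<in> quadrant"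
  by (simp add: quadrant_def)

lemma quadrant_scale: "x \<in> quadrant \<Longrightarrow> 0 \<le> c \<Longrightarrow> c *\<^sub>R x \<in> quadrant"
  by (simp add: quadrant_def)

lemma quadrant_pointed: "x \<in> quadrant \<Longrightarrow> - x \<in> quadrant \<Longrightarrow> x = 0"
  by (auto simp: quadrant_def vec_eq_iff intro: antisym)

lemma quadrant_multiple_pos:
  assumes "u \<in> quadrant" "c *\<^sub>R u \<in> quadrant" "c *\<^sub>R u \<noteq> 0"
  shows "0 < c"
proof (rule ccontr)
  assume "\<not> 0 < c"
  then have "- (c *\<^sub>R u) \<in> quadrant"
    using quadrant_scale[OF assms(1), of "- c"] by simp
  with assms quadrant_pointed show False by blast
qed

text \<open>Dividing by \<open>k\<close> turns \<open>k w + i u\<close> into a point on the line \<open>w + \<real> u\<close>; an element of the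
  quadrant at a positive level therefore yields one at level one with integer offset.\<close>

lemma quadrant_meets_level_one:
  fixes i k :: int
  assumes u: "u \<in> quadrant" and k: "0 < k"
    and mem: "of_int k *\<^sub>R w + of_int i *\<^sub>R u \<in> quadrant"
  shows "w + of_int \<bar>i\<bar> *\<^sub>R u \<in> quadrant"
proof -
  have "(of_int i :: real) \<le> of_int k * of_int \<bar>i\<bar>"
  proof -
    have "i \<le> k * \<bar>i\<bar>"
      using k mult_right_mono[of 1 k "\<bar>i\<bar>"] by linarith
    then show ?thesis by (metis of_int_le_iff of_int_mult)
  qed
  then have "0 \<le> of_int \<bar>i\<bar> - of_int i / (of_int k :: real)"
    using k by (simp add: field_simps)
  then have "(1 / of_int k) *\<^sub>R (of_int k *\<^sub>R w + of_int i *\<^sub>R u)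
      + (of_int \<bar>i\<bar> - of_int i / of_int k) *\<^sub>R u \<in> quadrant"
    using k by (intro quadrant_add[OF quadrant_scale[OF mem] quadrant_scale[OF u]]) auto
  then show ?thesis
    using k by (simp add: algebra_simps)
qed

lemma last_translate_in_quadrant:
  fixes j :: int
  assumes u: "u \<in> quadrant" "u \<noteq> 0" and mem: "w + of_int j *\<^sub>R u \<in> quadrant"
  obtains m :: int where "w + of_int m *\<^sub>R u \<in> quadrant" "w + of_int (m - 1) *\<^sub>R u \<notin> quadrant"
proof -
  define P where "P n \<longleftrightarrow> w + of_int (j - int n) *\<^sub>R u \<notin> quadrant" for n :: nat
  obtain a where a: "0 < u $ a"
    using u by (force simp: quadrant_def vec_eq_iff order_less_le)
  obtain n :: nat where n: "(w + of_int j *\<^sub>R u) $ a < of_nat n * u $ a"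
    using reals_Archimedean3[OF a] by blast
  then have "(w + of_int (j - int n) *\<^sub>R u) $ a < 0"
    by (simp add: algebra_simps)
  then have "P n"
    unfolding P_def quadrant_def mem_Collect_eq not_all not_le by (rule exI)
  moreover have "\<not> P 0" using mem by (simp add: P_def)
  ultimately obtain l where "\<not> P l" "P (Suc l)"
    by (metis not0_implies_Suc LeastI Least_le Suc_n_not_le_n)
  then show thesis
    using that[of "j - int l"] by (simp add: P_def algebra_simps)
qed

text \<open>By convexity, once \<open>w - u\<close> is outside the quadrant, the point \<open>k w + i u\<close> cannot be
  further than \<open>k (w - u)\<close> in the direction of \<open>- u\<close>.\<close>

lemma offset_lower_bound:
  fixes i k :: int
  assumes u: "u \<in> quadrant" and out: "w - u \<notin> quadrant" and k: "0 < k"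
    and mem: "of_int k *\<^sub>R w + of_int i *\<^sub>R u \<in> quadrant"
  shows "- k < i"
proof (rule ccontr)
  assume "\<not> - k < i"
  then have le: "(of_int i :: real) \<le> - of_int k" by linarith
  have "(of_int k *\<^sub>R w + of_int i *\<^sub>R u) + (- of_int k - of_int i) *\<^sub>R u \<in> quadrant"
    using le by (intro quadrant_add[OF mem quadrant_scale[OF u]]) auto
  then have "of_int k *\<^sub>R (w - u) \<in> quadrant"
    by (simp add: algebra_simps)
  then have "(1 / of_int k) *\<^sub>R (of_int k *\<^sub>R (w - u)) \<in> quadrant"
    by (rule quadrant_scale) (use k in simp)
  with out k show False by simp
qed

section \<open>Bases of two vectors\<close>

text \<open>A coordinate form of \<open>int_basis {u, w} L\<close>, with \<open>u\<close> and \<open>w\<close> distinct.\<close>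

definition int_frame :: "'a::real_vector \<Rightarrow> 'a \<Rightarrow> 'a set \<Rightarrow> bool" where
  "int_frame u w L \<longleftrightarrow>
     L = {of_int i *\<^sub>R u + of_int k *\<^sub>R w | i k :: int. True} \<and>
     (\<forall>i k :: int. of_int i *\<^sub>R u + of_int k *\<^sub>R w = 0 \<longrightarrow> i = 0 \<and> k = 0)"

lemma int_span_pair:
  "int_span {u, w} = {of_int i *\<^sub>R u + of_int k *\<^sub>R w | i k :: int. True}"
  by (auto simp: int_module.span_insert int_module.span_singleton int_module.span_empty algebra_simps)

lemma int_frame_imp_int_basis:
  assumes "int_frame u w L"
  shows "int_basis {u, w} L"
proof -
  have zero: "i = 0 \<and> k = 0" if "of_int i *\<^sub>R u + of_int k *\<^sub>R w = 0" for i k :: int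
    using assms that by (auto simp: int_frame_def)
  have "u \<noteq> w"
    using zero[of 1 "-1"] by auto
  then have "\<not> int_dependent {u, w}"
    using zero by (auto simp: int_module.dependent_finite)
  then show ?thesis
    using assms by (simp add: int_basis_def int_frame_def int_span_pair)
qed

lemma int_frame_mem: "int_frame u w L \<Longrightarrow> of_int i *\<^sub>R u + of_int k *\<^sub>R w \<in> L"
  by (auto simp: int_frame_def)

lemma int_frame_cases:
  assumes "int_frame u w L" "x \<in> L"
  obtains i k :: int where "x = of_int i *\<^sub>R u + of_int k *\<^sub>R w"
  using assms by (auto simp: int_frame_def)

lemma int_frame_zero:
  "int_frame u w L \<Longrightarrow> of_int i *\<^sub>R u + of_int k *\<^sub>R w = 0 \<Longrightarrow> i = 0 \<and> k = 0"
  by (auto simp: int_frame_def)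

text \<open>The general determinant-one form covers two changes of basis: the shift \<open>w \<mapsto> w + j u\<close>, and the
  completion of a vector with coprime coordinates by Bezout coefficients.\<close>

lemma int_frame_unimodular:
  fixes p q s t :: int
  assumes B: "int_frame b c L" and det: "p * s - q * t = 1"
  shows "int_frame (of_int p *\<^sub>R b + of_int q *\<^sub>R c) (of_int t *\<^sub>R b + of_int s *\<^sub>R c) L"
    (is "int_frame ?u ?w L")
proof -
  have expand: "of_int i *\<^sub>R ?u + of_int k *\<^sub>R ?w
      = of_int (i * p + k * t) *\<^sub>R b + of_int (i * q + k * s) *\<^sub>R c" for i k :: int
    by (simp add: algebra_simps)
  \<comment> \<open>Cramer's rule with determinant one.\<close>
  have fst_coord: "(s * m - t * n) * p + (p * n - q * m) * t = m" for m n :: int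
  proof -
    have "(s * m - t * n) * p + (p * n - q * m) * t = (p * s - q * t) * m"
      by (simp add: algebra_simps)
    then show ?thesis by (simp add: det)
  qed
  have snd_coord: "(s * m - t * n) * q + (p * n - q * m) * s = n" for m n :: int
  proof -
    have "(s * m - t * n) * q + (p * n - q * m) * s = (p * s - q * t) * n"
      by (simp add: algebra_simps)
    then show ?thesis by (simp add: det)
  qed
  have "L = {of_int i *\<^sub>R ?u + of_int k *\<^sub>R ?w | i k :: int. True}"
  proof (intro set_eqI iffI)
    fix x assume "x \<in> L"
    then obtain m n :: int where "x = of_int m *\<^sub>R b + of_int n *\<^sub>R c"
      by (rule int_frame_cases[OF B])
    then have "x = of_int (s * m - t * n) *\<^sub>R ?u + of_int (p * n - q * m) *\<^sub>R ?w"
      by (simp only: expand fst_coord snd_coord)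
    then show "x \<in> {of_int i *\<^sub>R ?u + of_int k *\<^sub>R ?w | i k :: int. True}" by blast
  next
    fix x assume "x \<in> {of_int i *\<^sub>R ?u + of_int k *\<^sub>R ?w | i k :: int. True}"
    then show "x \<in> L" using int_frame_mem[OF B] by (auto simp only: expand)
  qed
  moreover have "i = 0 \<and> k = 0" if "of_int i *\<^sub>R ?u + of_int k *\<^sub>R ?w = 0" for i k :: int
  proof -
    have e: "i * p + k * t = 0" "i * q + k * s = 0"
      using int_frame_zero[OF B] that by (simp_all only: expand)
    have "i * (p * s - q * t) = s * (i * p + k * t) - t * (i * q + k * s)"
      "k * (p * s - q * t) = p * (i * q + k * s) - q * (i * p + k * t)"
      by (simp_all add: algebra_simps)
    then show ?thesis by (simp only: e det) simp
  qed
  ultimately show ?thesis by (simp add: int_frame_def)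
qed

lemma int_frame_shift:
  assumes "int_frame u w L"
  shows "int_frame u (w + of_int j *\<^sub>R u) L"
  using int_frame_unimodular[OF assms, of 1 1 0 j] by (simp add: add.commute)

lemma int_frame_uminus:
  assumes "int_frame u w L"
  shows "int_frame u (- w) L"
proof -
  have eq: "of_int i *\<^sub>R u + of_int k *\<^sub>R (- w) = of_int i *\<^sub>R u + of_int (- k) *\<^sub>R w" for i k :: int
    by simp
  have "L = {of_int i *\<^sub>R u + of_int k *\<^sub>R (- w) | i k :: int. True}"
  proof (intro set_eqI iffI)
    fix x assume "x \<in> L"
    then obtain i k :: int where "x = of_int i *\<^sub>R u + of_int k *\<^sub>R w"
      by (rule int_frame_cases[OF assms])
    then have "x = of_int i *\<^sub>R u + of_int (- k) *\<^sub>R (- w)" by simp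
    then show "x \<in> {of_int i *\<^sub>R u + of_int k *\<^sub>R (- w) | i k :: int. True}" by blast
  next
    fix x assume "x \<in> {of_int i *\<^sub>R u + of_int k *\<^sub>R (- w) | i k :: int. True}"
    then show "x \<in> L" using int_frame_mem[OF assms] by (auto simp only: eq)
  qed
  moreover have "i = 0 \<and> k = 0" if "of_int i *\<^sub>R u + of_int k *\<^sub>R (- w) = 0" for i k :: int
    using int_frame_zero[OF assms, of i "- k"] that by simp
  ultimately show ?thesis unfolding int_frame_def by blast
qed

lemma lattice_of_rank_two_int_frame:
  assumes "lattice_of_rank 2 L"
  obtains b c where "int_frame b c L"
proof -
  obtain B where B: "card B = 2" "independent B" "L = int_span B"
    using assms by (auto simp: lattice_of_rank_def)
  then obtain b c where bc: "B = {b, c}" "b \<noteq> c" by (auto simp: card_2_iff)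
  have "i = 0 \<and> k = 0" if zero: "of_int i *\<^sub>R b + of_int k *\<^sub>R c = 0" for i k :: int
  proof -
    define f where "f x = (if x = b then of_int i else of_int k :: real)" for x
    have "(\<Sum>x\<in>B. f x *\<^sub>R x) = 0" using bc zero by (auto simp: f_def)
    then have "f x = 0" if "x \<in> B" for x
      using independentD[OF B(2) _ order_refl] bc(1) that by auto
    from this[of b] this[of c] bc show ?thesis by (simp add: f_def)
  qed
  then have "int_frame b c L" using B bc by (simp add: int_frame_def int_span_pair)
  then show thesis by (rule that)
qed

section \<open>Indecomposable vectors\<close>

lemma indecomposableD:
  assumes "indecomposable L x" "x = y + z"
    and "y \<in> L" "y \<in> quadrant" "z \<in> L" "z \<in> quadrant"
  shows "y = 0 \<or> z = 0"
  using assms by (auto simp: indecomposable_def nonneg_part_eq)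

lemma indecomposable_mem:
  "indecomposable L x \<Longrightarrow> x \<in> L \<and> x \<in> quadrant \<and> x \<noteq> 0"
  by (auto simp: indecomposable_def nonneg_part_eq)

text \<open>If \<open>d > 1\<close> divided both coordinates, \<open>u = d x\<close> would split as \<open>x + (d - 1) x\<close>. So the
  coordinates are coprime, and Bezout coefficients give the second basis vector.\<close>

lemma indecomposable_extends_to_frame:
  assumes B: "int_frame b c L" and u: "indecomposable L u"
  obtains w where "int_frame u w L"
proof -
  have mem: "u \<in> L" "u \<in> quadrant" "u \<noteq> 0"
    using indecomposable_mem[OF u] by auto
  obtain p q :: int where pq: "u = of_int p *\<^sub>R b + of_int q *\<^sub>R c"
    using mem(1) by (rule int_frame_cases[OF B])
  define d where "d = gcd p q"
  have "\<not> (p = 0 \<and> q = 0)" using mem(3) pq by auto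
  then have d0: "0 < d" unfolding d_def using gcd_pos_int by blast
  obtain p' q' where p'q': "p = d * p'" "q = d * q'"
    unfolding d_def by (meson dvd_def gcd_dvd1 gcd_dvd2)
  define x where "x = of_int p' *\<^sub>R b + of_int q' *\<^sub>R c"
  have ux: "u = of_int d *\<^sub>R x" by (simp add: pq p'q' x_def algebra_simps)
  have xL: "x \<in> L" unfolding x_def by (rule int_frame_mem[OF B])
  have "(1 / of_int d) *\<^sub>R u \<in> quadrant" using mem(2) d0 by (intro quadrant_scale) auto
  then have xQ: "x \<in> quadrant" using ux d0 by simp
  have "x + of_int (d - 1) *\<^sub>R x = u" by (simp add: ux algebra_simps)
  moreover have "of_int (d - 1) *\<^sub>R x \<in> L"
  proof -
    have "of_int (d - 1) *\<^sub>R x = of_int ((d - 1) * p') *\<^sub>R b + of_int ((d - 1) * q') *\<^sub>R c"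
      by (simp add: x_def algebra_simps)
    then show ?thesis using int_frame_mem[OF B] by presburger
  qed
  moreover have "of_int (d - 1) *\<^sub>R x \<in> quadrant" using xQ d0 by (intro quadrant_scale) auto
  ultimately have "x = 0 \<or> of_int (d - 1) *\<^sub>R x = 0"
    using indecomposableD[OF u] xL xQ by metis
  then have "d = 1" using mem(3) ux by auto
  then obtain s t where st: "s * p + t * q = 1"
    using bezout_int[of p q] by (auto simp: d_def)
  then have "int_frame u (of_int (- t) *\<^sub>R b + of_int s *\<^sub>R c) L"
    unfolding pq by (intro int_frame_unimodular[OF B]) (simp add: algebra_simps)
  then show thesis by (rule that)
qed

text \<open>Suppose \<open>w = y + z\<close> with levels \<open>n + 1\<close> and \<open>-n\<close>. For \<open>n = 0\<close> the vector \<open>z\<close> is a positive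
  multiple of \<open>u\<close>, and \<open>y\<close> is too far in the direction of \<open>- u\<close>. For \<open>n > 0\<close> the quadrant also meets level
  \<open>-1\<close>; let \<open>z' = m u - w\<close> be its last element there. Since \<open>m u = w + z'\<close> and \<open>u\<close> is
  indecomposable, \<open>m \<ge> 2\<close>. Writing \<open>y = i u + (n + 1) w\<close>, the lower bounds for the offset of \<open>y\<close>
  from \<open>(n + 1) w\<close> and for that of \<open>z\<close> from \<open>n z'\<close> give \<open>- (n + 1) < i < - n (m - 1)\<close>, which
  no integer \<open>i\<close> satisfies.\<close>

lemma indecomposable_neighbour:
  assumes u: "indecomposable L u" and F: "int_frame u w L"
    and w: "w \<in> quadrant" and out: "w - u \<notin> quadrant"
  shows "indecomposable L w"
proof -
  have uQ: "u \<in> quadrant" "u \<noteq> 0" using indecomposable_mem[OF u] by auto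
  have wL: "w \<in> L" using int_frame_mem[OF F, of 0 1] by simp
  have w0: "w \<noteq> 0" using int_frame_zero[OF F, of 0 1] by auto
  \<comment> \<open>The two summands are interchangeable; one of them has positive level.\<close>
  have no_split: False
    if z: "z \<in> quadrant" "z \<noteq> 0" and y: "y \<in> quadrant" and yz: "w = y + z"
      and yc: "y = of_int i *\<^sub>R u + of_int k *\<^sub>R w" and k: "0 < k" for y z and i k :: int
  proof -
    define n where "n = k - 1"
    have zc: "z = of_int (- i) *\<^sub>R u + of_int (- n) *\<^sub>R w"
      using yz yc by (simp add: n_def algebra_simps)
    have i: "- k < i"
      using offset_lower_bound[OF uQ(1) out k, of i] y yc by (simp add: add.commute)
    show False
    proof (cases "n = 0")
      case True
      then have "0 < (of_int (- i) :: real)"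
        using quadrant_multiple_pos[OF uQ(1), of "of_int (- i)"] z zc by simp
      then show False using i True by (simp add: n_def)
    next
      case False
      then have n: "0 < n" using k by (simp add: n_def)
      have "of_int n *\<^sub>R (- w) + of_int (- i) *\<^sub>R u \<in> quadrant"
        using z zc by (simp add: algebra_simps)
      then obtain m :: int where m: "- w + of_int m *\<^sub>R u \<in> quadrant"
          "- w + of_int (m - 1) *\<^sub>R u \<notin> quadrant"
        using last_translate_in_quadrant[OF uQ] quadrant_meets_level_one[OF uQ(1) n] by metis
      define z' where "z' = - w + of_int m *\<^sub>R u"
      have z'Q: "z' \<in> quadrant" "z' - u \<notin> quadrant"
        using m by (simp_all add: z'_def algebra_simps)
      have z'L: "z' \<in> L" using int_frame_mem[OF F, of m "-1"] by (simp add: z'_def)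
      have z'0: "z' \<noteq> 0" using int_frame_zero[OF F, of m "-1"] by (auto simp: z'_def)
      have sum: "w + z' = of_int m *\<^sub>R u" by (simp add: z'_def)
      have "w + z' \<noteq> 0"
        using quadrant_pointed[OF w] z'Q(1) w0 by (metis add_eq_0_iff)
      then have "0 < (of_int m :: real)"
        using quadrant_multiple_pos[OF uQ(1)] quadrant_add[OF w z'Q(1)] sum by metis
      moreover have "m \<noteq> 1"
        using indecomposableD[OF u _ wL w z'L z'Q(1)] sum w0 z'0 by auto
      ultimately have m2: "2 \<le> m" by simp
      have "of_int n *\<^sub>R z' + of_int (- i - n * m) *\<^sub>R u = z"
        by (simp add: zc z'_def algebra_simps)
      then have "- n < - i - n * m"
        using offset_lower_bound[OF uQ(1) z'Q(2) n] z by metis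
      moreover have "n * 2 \<le> n * m" using m2 n by simp
      ultimately show False using i by (simp add: n_def)
    qed
  qed
  have "y = 0 \<or> z = 0"
    if "y \<in> L" "y \<in> quadrant" "z \<in> L" "z \<in> quadrant" and yz: "w = y + z" for y z
  proof (rule ccontr)
    assume nz: "\<not> (y = 0 \<or> z = 0)"
    obtain i k :: int where yc: "y = of_int i *\<^sub>R u + of_int k *\<^sub>R w"
      by (rule int_frame_cases[OF F \<open>y \<in> L\<close>])
    have zc: "z = of_int (- i) *\<^sub>R u + of_int (1 - k) *\<^sub>R w"
      using yz yc by (simp add: algebra_simps)
    show False
    proof (cases "0 < k")
      case True
      then show ?thesis using no_split[OF _ _ _ yz yc] that nz by blast
    next
      case False
      have "w = z + y" using yz by (simp add: add.commute)
      then show ?thesis using no_split[OF _ _ _ _ zc] that nz False by auto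
    qed
  qed
  then show ?thesis
    using w wL w0 by (auto simp: indecomposable_def nonneg_part_eq)
qed

lemma consecutive_at_positive_level:
  fixes i k :: int
  assumes uv: "consecutive L u v" and F: "int_frame u w L"
    and v: "v = of_int i *\<^sub>R u + of_int k *\<^sub>R w" and k: "0 < k"
  shows "int_frame u v L"
proof -
  have iu: "indecomposable L u" and iv: "indecomposable L v"
    using uv by (auto simp: consecutive_def)
  have uQ: "u \<in> quadrant" "u \<noteq> 0" and vQ: "v \<in> quadrant"
    using indecomposable_mem[OF iu] indecomposable_mem[OF iv] by auto
  have "of_int k *\<^sub>R w + of_int i *\<^sub>R u \<in> quadrant" using vQ v by (simp add: add.commute)
  then obtain m :: int where m: "w + of_int m *\<^sub>R u \<in> quadrant"
      "w + of_int (m - 1) *\<^sub>R u \<notin> quadrant"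
    using last_translate_in_quadrant[OF uQ] quadrant_meets_level_one[OF uQ(1) k] by metis
  define x where "x = w + of_int m *\<^sub>R u"
  define j where "j = i - k * m"
  have xQ: "x \<in> quadrant" "x - u \<notin> quadrant" using m by (simp_all add: x_def algebra_simps)
  have Fx: "int_frame u x L" unfolding x_def by (rule int_frame_shift[OF F])
  have ix: "indecomposable L x" by (rule indecomposable_neighbour[OF iu Fx xQ])
  have vx: "v = of_int j *\<^sub>R u + of_int k *\<^sub>R x" by (simp add: v x_def j_def algebra_simps)
  have "x = v"
  proof (cases "0 \<le> j")
    case True
    define r where "r = of_int j *\<^sub>R u + of_int (k - 1) *\<^sub>R x"
    have "r \<in> L" unfolding r_def by (rule int_frame_mem[OF Fx])
    moreover have "r \<in> quadrant"
      unfolding r_def using True k uQ xQ by (intro quadrant_add quadrant_scale) auto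
    moreover have vr: "v = x + r" by (simp add: vx r_def algebra_simps)
    ultimately have "x = 0 \<or> r = 0"
      using indecomposableD[OF iv] indecomposable_mem[OF ix] by blast
    then show ?thesis using vr indecomposable_mem[OF ix] by auto
  next
    case False
    have "x = (of_int (- j) / of_int k) *\<^sub>R u + (1 / of_int k) *\<^sub>R v"
      using k by (simp add: vx algebra_simps)
    moreover have "0 \<le> (of_int (- j) / of_int k :: real)" "0 \<le> (1 / of_int k :: real)"
      using False k by (simp_all add: divide_nonpos_pos)
    ultimately have "x \<in> cone2 u v" unfolding cone2_def by blast
    then have "x = u \<or> x = v" using uv ix by (auto simp: consecutive_def)
    moreover have "x \<noteq> u" using int_frame_zero[OF Fx, of 1 "-1"] by auto
    ultimately show ?thesis by blast
  qed
  then show ?thesis using Fx by simp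
qed

theorem lemma4p3:
  fixes L :: "(real ^ 2) set" and u v :: "real ^ 2"
  assumes "lattice_of_rank 2 L"
    and "consecutive L u v"
    and "u \<noteq> v"
  shows "int_basis {u, v} L"
proof -
  have iu: "indecomposable L u" and iv: "indecomposable L v"
    using assms(2) by (auto simp: consecutive_def)
  obtain b c where "int_frame b c L"
    using assms(1) by (rule lattice_of_rank_two_int_frame)
  then obtain w where F: "int_frame u w L"
    using iu by (rule indecomposable_extends_to_frame)
  have "v \<in> L" using indecomposable_mem[OF iv] by blast
  then obtain i k :: int where v: "v = of_int i *\<^sub>R u + of_int k *\<^sub>R w"
    by (rule int_frame_cases[OF F])
  consider "0 < k" | "k < 0" | "k = 0" by linarith
  then have "int_frame u v L"
  proof cases
    case 1
    then show ?thesis using consecutive_at_positive_level[OF assms(2) F v] by blast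
  next
    case 2
    then show ?thesis
      using consecutive_at_positive_level[OF assms(2) int_frame_uminus[OF F], of i "- k"] v by simp
  next
    case 3
    then have vi: "v = of_int i *\<^sub>R u" using v by simp
    have uQ: "u \<in> L" "u \<in> quadrant" "u \<noteq> 0" using indecomposable_mem[OF iu] by auto
    have "0 < (of_int i :: real)"
      using quadrant_multiple_pos[OF uQ(2)] indecomposable_mem[OF iv] vi by metis
    then have "of_int (i - 1) *\<^sub>R u \<in> quadrant"
      using uQ by (intro quadrant_scale) auto
    moreover have "of_int (i - 1) *\<^sub>R u \<in> L"
      using int_frame_mem[OF F, of "i - 1" 0] by simp
    moreover have "v = u + of_int (i - 1) *\<^sub>R u" by (simp add: vi algebra_simps)
    ultimately have "v = u"
      using indecomposableD[OF iv _ uQ(1,2)] uQ(3) by (metis add.right_neutral)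
    then show ?thesis using assms(3) by simp
  qed
  then show ?thesis by (rule int_frame_imp_int_basis)
qed

end
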